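(* Let $\{\varphi_k\}_{k\in\mathbb Z}$ be neutral fermions, satisfying $$\varphi_m\varphi_n+\varphi_n\varphi_m=2(-1)^m\delta_{m+n,0},\qquad m,n\in\mathbb Z.$$ Let $A=(A_{i,j})_{i,j\in\mathbb Z}$ be a complex matrix with the property that for any fixed $i$, $A_{i,j}=0$ for $j\ll0$. Set $\tilde\varphi_k=\sum_{i\in\mathbb Z}A_{k,i}\varphi_i$. Then $\{\tilde\varphi_i\}_{i\in\mathbb Z}$ satisfy the anticommutation relations of neutral fermions (the relations above with $\tilde\varphi$ in place of $\varphi$) if and only if $(A^{-1})_{i,j}=(-1)^{i-j}A_{-j,-i}$.
   Context: $A^{-1}$ denotes the (left) inverse of the infinite matrix $A$: one writes $C=A^{-1}$ if $\sum_{k\in\mathbb Z}C_{i,k}A_{k,j}=\delta_{i,j}$. $\Lambda=\mathbb C[p_1,p_2,\dots]$ is the ring of symmetric functions, $h_k,e_k$ complete and elementary symmetric functions; $f^\perp$ is the adjoint of multiplication by $f$ for the scalar product in which Schur functions are orthonormal ($p_n^\perp=n\,\partial/\partial p_n$). $H(u)=\sum_{k\ge0}h_ku^k$, $E(u)=\sum_{k\ge0}e_ku^k$, $E^\perp(u)=\sum_{k\ge0}e_k^\perp u^{-k}$. The neutral fermions are the operators $\varphi_j$ on $\mathcal B_{odd}=\mathbb C[p_1,p_3,p_5,\dots]$ defined by $\varphi(u)=\sum_{j\in\mathbb Z}\varphi_ju^{-j}=E(u)H(u)E^\perp(-u)$ (this preserves $\mathcal B_{odd}$). For each $b\in\mathcal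 B_{odd}$ one has $\varphi_k(b)=0$ for $k\gg0$, so the $\tilde\varphi_k$ are well defined.
   Formalization: With A^{-1} as left inverse the claim fails for some infinite A; writing B for the matrix (-1)^{i-j}A_{-j,-i}, it is proved that the relations hold iff AB=1 for all A, and iff BA=1 if A has a two-sided inverse, A and inverse having row bounds tending to infinity. *)

theory Defs
  imports Complex_Main "HOL-Library.Poly_Mapping" "HOL-Library.Groups_Big_Fun"
begin

text \<open>
  Polynomials over the complex numbers in the power sums: the monomial
  \<open>m :: nat \<Rightarrow>\<^sub>0 nat\<close> stands for the product of the \<open>p\<^sub>n\<close> to the power \<open>lookup m n\<close>.
  The power sums are indexed by \<open>n \<ge> 1\<close>; the type also has a variable of index \<open>0\<close>, which is
  never used (it occurs neither in the generators below nor in \<open>B_odd\<close>).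
\<close>

type_synonym symfun = "(nat \<Rightarrow>\<^sub>0 nat) \<Rightarrow>\<^sub>0 complex"

definition smul :: "complex \<Rightarrow> symfun \<Rightarrow> symfun" where
  "smul c f = Poly_Mapping.single 0 c * f"

definition psum :: "nat \<Rightarrow> symfun" where
  "psum n = Poly_Mapping.single (Poly_Mapping.single n 1) 1"

text \<open>
  Complete and elementary symmetric functions, by Newton's identities
  \<open>n h\<^sub>n = \<Sum>i=1..n. p\<^sub>i h\<^sub>n\<^sub>-\<^sub>i\<close> and \<open>n e\<^sub>n = \<Sum>i=1..n. (-1)^(i-1) p\<^sub>i e\<^sub>n\<^sub>-\<^sub>i\<close>.
\<close>

fun hsym :: "nat \<Rightarrow> symfun" where
  "hsym 0 = 1"
| "hsym (Suc n) = smul (1 / of_nat (Suc n)) (\<Sum>i\<le>n. psum (Suc i) * hsym (n - i))"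

fun esym :: "nat \<Rightarrow> symfun" where
  "esym 0 = 1"
| "esym (Suc n) = smul (1 / of_nat (Suc n)) (\<Sum>i\<le>n. (-1) ^ i * psum (Suc i) * esym (n - i))"

text \<open>
  The adjoint of multiplication by \<open>p\<^sub>n\<close> is \<open>n \<partial>/\<partial>p\<^sub>n\<close>.  Monomials in which \<open>p\<^sub>n\<close> does not
  occur are killed by the coefficient, so the truncated subtraction of exponents is harmless.
\<close>

definition psum_perp :: "nat \<Rightarrow> symfun \<Rightarrow> symfun" where
  "psum_perp n f = (\<Sum>m\<in>Poly_Mapping.keys f.
     Poly_Mapping.single (m - Poly_Mapping.single n 1)
       (of_nat n * of_nat (Poly_Mapping.lookup m n) * Poly_Mapping.lookup f m))"

text \<open>
  \<open>perp g\<close> is \<open>g\<^sup>\<bottom>\<close>: each \<open>p\<^sub>n\<close> in \<open>g\<close> is replaced by \<open>psum_perp n\<close>.  The \<open>psum_perp n\<close>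
  commute, so the order of composition chosen in \<open>monom_perp\<close> is immaterial.
\<close>

definition monom_perp :: "(nat \<Rightarrow>\<^sub>0 nat) \<Rightarrow> symfun \<Rightarrow> symfun" where
  "monom_perp m f =
     fold (\<lambda>n. psum_perp n ^^ Poly_Mapping.lookup m n) (sorted_list_of_set (Poly_Mapping.keys m)) f"

definition perp :: "symfun \<Rightarrow> symfun \<Rightarrow> symfun" where
  "perp g f = (\<Sum>m\<in>Poly_Mapping.keys g. smul (Poly_Mapping.lookup g m) (monom_perp m f))"

definition B_odd :: "symfun set" where
  "B_odd = {f. \<forall>m\<in>Poly_Mapping.keys f. \<forall>n\<in>Poly_Mapping.keys m. odd n}"

text \<open>
  \<open>phi j\<close> is the coefficient of \<open>u\<close> to the power \<open>-j\<close> in \<open>E(u) H(u) E\<^sup>\<bottom>(-u)\<close>, where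
  \<open>E\<^sup>\<bottom>(-u)\<close> is the sum over \<open>c\<close> of \<open>(-1)^c perp (esym c)\<close> times \<open>u\<close> to the power \<open>-c\<close>.
  For each polynomial \<open>f\<close> only finitely many summands are nonzero, since \<open>perp (esym c) f = 0\<close>
  for \<open>c\<close> greater than the degree of \<open>f\<close> (with \<open>p\<^sub>n\<close> in degree \<open>n\<close>).
\<close>

definition phi :: "int \<Rightarrow> symfun \<Rightarrow> symfun" where
  "phi j f = Sum_any (\<lambda>(a, b, c).
     if int a + int b - int c = - j then (-1) ^ c * esym a * hsym b * perp (esym c) f else 0)"

definition neutral_relations :: "(int \<Rightarrow> symfun \<Rightarrow> symfun) \<Rightarrow> bool" where
  "neutral_relations \<Phi> \<longleftrightarrow> (\<forall>m n. \<forall>f\<in>B_odd.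
     \<Phi> m (\<Phi> n f) + \<Phi> n (\<Phi> m f) = (if m + n = 0 then smul (2 * (-1) powi m) f else 0))"

type_synonym cmatrix = "int \<Rightarrow> int \<Rightarrow> complex"

definition rows_bounded_below :: "cmatrix \<Rightarrow> bool" where
  "rows_bounded_below A \<longleftrightarrow> (\<forall>i. \<exists>N. \<forall>j<N. A i j = 0)"

text \<open>
  If the rows of \<open>A\<close> are bounded below, the sum is finite on each polynomial,
  because \<open>phi i f = 0\<close> for \<open>i\<close> large.
\<close>

definition phi_tilde :: "cmatrix \<Rightarrow> int \<Rightarrow> symfun \<Rightarrow> symfun" where
  "phi_tilde A k f = Sum_any (\<lambda>i. smul (A k i) (phi i f))"

text \<open>
  \<open>left_inverse C A\<close>: the product \<open>C A\<close> is defined by finite sums and is the identity matrix.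
  The finiteness clause is needed since \<open>Sum_any\<close> is \<open>0\<close> on infinite supports.

  For infinite matrices the side matters.  If \<open>f\<close> fixes \<open>0\<close> and moves every other integer by \<open>2\<close>
  away from \<open>0\<close>, and \<open>A i j\<close> is \<open>1\<close> for \<open>j = f i\<close> and \<open>0\<close> otherwise, then \<open>phi_tilde A k\<close> is
  \<open>phi (f k)\<close>.  These operators satisfy the neutral fermion relations, and \<open>A\<close> times
  \<open>twisted_transpose A\<close> is the identity, but \<open>twisted_transpose A\<close> times \<open>A\<close> is not, since
  column \<open>1\<close> of \<open>A\<close> is zero.
\<close>

definition left_inverse :: "cmatrix \<Rightarrow> cmatrix \<Rightarrow> bool" where
  "left_inverse C A \<longleftrightarrow> (\<forall>i j. finite {k. C i k * A k j \<noteq> 0} \<and>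
     Sum_any (\<lambda>k. C i k * A k j) = (if i = j then 1 else 0))"

definition twisted_transpose :: "cmatrix \<Rightarrow> cmatrix" where
  "twisted_transpose A i j = (-1) powi (i - j) * A (- j) (- i)"

text \<open>
  Matrices whose rows are bounded below, with the bounds tending to infinity for rows \<open>k\<close> tending
  to infinity.  They form a ring, as the continuous endomorphisms of the space of formal
  combinations of the \<open>phi i\<close> with coefficients vanishing for \<open>i\<close> small.
  For merely row-bounded matrices products need not be defined.
\<close>

definition continuous_matrix :: "cmatrix \<Rightarrow> bool" where
  "continuous_matrix A \<longleftrightarrow> rows_bounded_below A \<and> (\<forall>N. \<exists>K. \<forall>k>K. \<forall>j<N. A k j = 0)"

definition invertible_matrix :: "cmatrix \<Rightarrow> bool" where
  "invertible_matrix A \<longleftrightarrow> continuous_matrix A \<and>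
     (\<exists>C. continuous_matrix C \<and> left_inverse C A \<and> left_inverse A C)"

end

(*
  The series Q(u) = E(u)H(u) satisfies Q(u)Q(-u) = 1, and the adjoint of E(-u) is
  the substitution of p_n - u^(-n) for p_n, a ring homomorphism taking Q(v) to
  (1 - v/u)/(1 + v/u) Q(v).  So phi(u) phi(v) is the normally ordered product, symmetric in u and
  v, times (1 - v/u)/(1 + v/u) expanded in powers of v/u.  Adding the product in the other order
  gives twice the delta function at v = -u, where the normally ordered product is the
  identity on odd symmetric functions: p_n - u^(-n) - (-u)^(-n) = p_n for odd n.

  By bilinearity the anticommutator of two combinations of the phi_i is 2 (-1)^n times an entry of
  A A', where A' is the twisted transpose; and for invertible A one-sided inverses are two-sided.
*)
theory Submission
  imports Defs "HOL-Computational_Algebra.Formal_Power_Series"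
begin

unbundle fps_syntax

section \<open>Differentiation with respect to the power sums\<close>

abbreviation var :: "nat \<Rightarrow> nat \<Rightarrow>\<^sub>0 nat" where
  "var n \<equiv> Poly_Mapping.single n 1"

abbreviation lk :: "('a \<Rightarrow>\<^sub>0 'b::zero) \<Rightarrow> 'a \<Rightarrow> 'b" where
  "lk \<equiv> Poly_Mapping.lookup"

lemma vector_space_smul: "vector_space smul"
  by unfold_locales (simp_all add: smul_def algebra_simps single_add mult_single flip: mult.assoc)

interpretation symfun: vector_space smul
  by (rule vector_space_smul)

abbreviation linear_op :: "(symfun \<Rightarrow> symfun) \<Rightarrow> bool" where
  "linear_op \<equiv> module_hom smul smul"

lemma linear_opI:
  "(\<And>f g. T (f + g) = T f + T g) \<Longrightarrow> (\<And>c f. T (smul c f) = smul c (T f)) \<Longrightarrow> linear_op T"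
  by unfold_locales auto

lemma linear_op_smul: "linear_op (smul c)"
  by (intro linear_opI) (simp_all add: symfun.scale_right_distrib mult.commute)

lemma linear_op_compose: "linear_op S \<Longrightarrow> linear_op T \<Longrightarrow> linear_op (\<lambda>f. S (T f))"
  using module_hom_compose[of smul smul T smul S] by (simp add: o_def)

lemma smul_mult_left: "smul c f * g = smul c (f * g)"
  and smul_mult_right: "f * smul c g = smul c (f * g)"
  by (simp_all add: smul_def mult_ac)

lemma lookup_smul: "lk (smul c f) m = c * lk f m"
proof -
  have "smul c f = Poly_Mapping.map ((*) c) f"
    by (simp add: smul_def mult_map_scale_conv_mult)
  then show ?thesis
    by (simp add: Poly_Mapping.map.rep_eq when_def)
qed

lemma smul_of_nat: "smul (of_nat n) f = of_nat n * f"
  by (simp add: smul_def)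

text \<open>Exponents are natural numbers, so \<open>m' - var n\<close> truncates;
  \<open>lk m' n \<noteq> 0\<close> is what makes it undo the addition of
  \<open>var n\<close>.\<close>

lemma add_var_eq_iff: "m' = m + var n \<longleftrightarrow> lk m' n \<noteq> 0 \<and> m' - var n = m"
proof
  assume "lk m' n \<noteq> 0 \<and> m' - var n = m"
  then show "m' = m + var n"
    by (intro poly_mapping_eqI) (auto simp: lookup_add lookup_minus lookup_single when_def)
qed (auto simp: lookup_add)

text \<open>Only the monomial \<open>m + var n\<close> differentiates to a multiple of
  \<open>m\<close>. In this form linearity and commutation are coefficientwise identities.\<close>

lemma lookup_psum_perp:
  "lk (psum_perp n f) m = of_nat n * of_nat (lk m n + 1) * lk f (m + var n)"
proof -
  have "lk (psum_perp n f) m = (\<Sum>m'\<in>Poly_Mapping.keys f.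
      if m' = m + var n then of_nat n * of_nat (lk m' n) * lk f m' else 0)"
    unfolding psum_perp_def lookup_sum
    by (intro sum.cong refl, subst add_var_eq_iff) (auto simp: lookup_single when_def)
  also have "\<dots> = of_nat n * of_nat (lk m n + 1) * lk f (m + var n)"
    by (auto simp: sum.delta lookup_add in_keys_iff)
  finally show ?thesis .
qed

lemma linear_psum_perp: "linear_op (psum_perp n)"
  by (intro linear_opI; intro poly_mapping_eqI)
    (simp_all add: lookup_psum_perp lookup_add lookup_smul algebra_simps)

lemma psum_perp_commute: "psum_perp a (psum_perp b f) = psum_perp b (psum_perp a f)"
  by (rule poly_mapping_eqI)
    (auto simp: lookup_psum_perp lookup_add lookup_single when_def algebra_simps)

lemma lookup_psum_mult: "lk (psum n * f) m = (if lk m n = 0 then 0 else lk f (m - var n))"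
proof -
  have "lk (psum n * f) m = (\<Sum>q. lk f q when m = var n + q)"
    unfolding psum_def lookup_mult by (simp add: lookup_single when_mult Sum_any_when_dependent_prod_right)
  also have "(\<lambda>q. lk f q when m = var n + q) = (\<lambda>q. (lk f q when lk m n \<noteq> 0) when q = m - var n)"
    using add_var_eq_iff[of m _ n] by (auto simp: when_def add.commute)
  finally show ?thesis
    by (simp add: when_def)
qed

text \<open>The Leibniz rule for \<open>n\<close> times the derivative in \<open>p_n\<close>, with a
  generator as one factor.\<close>

lemma psum_perp_psum_mult:
  "psum_perp i (psum n * f) = psum n * psum_perp i f + (if i = n then of_nat n * f else 0)"
proof (rule poly_mapping_eqI)
  fix m
  have *: "m + var i - var n = m - var n + var i" if "lk m n \<noteq> 0"
    using that by (intro poly_mapping_eqI) (auto simp: lookup_add lookup_minus lookup_single when_def)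
  have **: "m - var n + var n = m" if "lk m n \<noteq> 0"
    using add_var_eq_iff[of m "m - var n" n] that by simp
  show "lk (psum_perp i (psum n * f)) m =
      lk (psum n * psum_perp i f + (if i = n then of_nat n * f else 0)) m"
    using * **
    by (cases "lk m n")
      (auto simp: lookup_psum_perp lookup_psum_mult lookup_add lookup_minus lookup_single when_def
        lookup_smul distrib_left distrib_right simp flip: smul_of_nat)
qed

lemma funpow_psum_perp_commute:
  "(psum_perp a ^^ l) ((psum_perp b ^^ k) f) = (psum_perp b ^^ k) ((psum_perp a ^^ l) f)"
proof -
  have "psum_perp a ((psum_perp b ^^ k) f) = (psum_perp b ^^ k) (psum_perp a f)" for f
    by (induction k) (auto simp: psum_perp_commute[of a])
  then show ?thesis
    by (induction l) auto
qed

text \<open>The factors commute, so the fold does not depend on the order, and indices outside the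
  support contribute zeroth powers. Two monomials can thus be compared over one set
  \<open>S\<close>.\<close>

lemma monom_perp_eq_fold:
  assumes "finite S" "Poly_Mapping.keys m \<subseteq> S"
  shows "monom_perp m f = Finite_Set.fold (\<lambda>n. psum_perp n ^^ lk m n) f S"
proof -
  let ?F = "Finite_Set.fold (\<lambda>n. psum_perp n ^^ lk m n) f" and ?K = "Poly_Mapping.keys m"
  interpret comp_fun_commute_on UNIV "\<lambda>n. psum_perp n ^^ lk m n"
    by unfold_locales (auto simp: funpow_psum_perp_commute fun_eq_iff)
  have "?F (?K \<union> T) = ?F ?K" if "finite T" "T \<inter> ?K = {}" for T
    using that by (induction T) (auto simp: in_keys_iff)
  from this[of "S - ?K"] assms have "?F S = ?F ?K"
    by (auto simp: Un_absorb1)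
  moreover have "monom_perp m f = ?F ?K"
    unfolding monom_perp_def
    using fold_set_fold_remdups[of "sorted_list_of_set ?K" f]
    by (simp add: distinct_remdups_id)
  ultimately show ?thesis by simp
qed

section \<open>Adjoint operators\<close>

lemma perp_superset:
  assumes "finite S" "Poly_Mapping.keys g \<subseteq> S"
  shows "perp g f = (\<Sum>m\<in>S. smul (lk g m) (monom_perp m f))"
  unfolding perp_def using assms
  by (intro sum.mono_neutral_left) (auto simp: in_keys_iff)

lemma linear_perp_left: "linear_op (\<lambda>g. perp g f)"
proof (intro linear_opI)
  fix g h :: symfun and c :: complex
  let ?S = "Poly_Mapping.keys g \<union> Poly_Mapping.keys h"
  show "perp (g + h) f = perp g f + perp h f"
    using Poly_Mapping.keys_add[of g h]
    by (simp add: perp_superset[of ?S] lookup_add symfun.scale_left_distrib sum.distrib)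
  have "Poly_Mapping.keys (smul c g) \<subseteq> Poly_Mapping.keys g"
    by (auto simp: in_keys_iff lookup_smul)
  then show "perp (smul c g) f = smul c (perp g f)"
    by (simp add: perp_superset[of "Poly_Mapping.keys g"] lookup_smul symfun.scale_sum_right)
qed

lemma monom_perp_zero: "monom_perp 0 f = f"
  by (simp add: monom_perp_def)

text \<open>Only the factor at \<open>n\<close> changes, and commutation lets it be applied
  last.\<close>

lemma monom_perp_add_var: "monom_perp (m + var n) f = psum_perp n (monom_perp m f)"
proof -
  let ?S = "insert n (Poly_Mapping.keys m)" and ?T = "Poly_Mapping.keys m - {n}"
  have keys: "Poly_Mapping.keys (m + var n) \<subseteq> ?S"
    using Poly_Mapping.keys_add[of m "var n"] by auto
  interpret m: comp_fun_commute_on UNIV "\<lambda>n. psum_perp n ^^ lk m n"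
    by unfold_locales (auto simp: funpow_psum_perp_commute fun_eq_iff)
  interpret m': comp_fun_commute_on UNIV "\<lambda>k. psum_perp k ^^ lk (m + var n) k"
    by unfold_locales (auto simp: funpow_psum_perp_commute fun_eq_iff)
  have T: "Finite_Set.fold (\<lambda>k. psum_perp k ^^ lk (m + var n) k) f ?T =
      Finite_Set.fold (\<lambda>k. psum_perp k ^^ lk m k) f ?T"
    by (rule fold_closed_eq[of _ UNIV]) (auto simp: lookup_add lookup_single when_def)
  have "monom_perp (m + var n) f =
      Finite_Set.fold (\<lambda>k. psum_perp k ^^ lk (m + var n) k) f (insert n ?T)"
    using monom_perp_eq_fold[OF _ keys, of f] by simp
  also have "\<dots> = (psum_perp n ^^ lk (m + var n) n) (Finite_Set.fold (\<lambda>k. psum_perp k ^^ lk m k) f ?T)"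
    by (subst m'.fold_insert) (use T in auto)
  also have "\<dots> = psum_perp n ((psum_perp n ^^ lk m n)
      (Finite_Set.fold (\<lambda>k. psum_perp k ^^ lk m k) f ?T))"
    by (simp add: lookup_add)
  also have "\<dots> = psum_perp n (Finite_Set.fold (\<lambda>k. psum_perp k ^^ lk m k) f (insert n ?T))"
    by (subst m.fold_insert) auto
  also have "\<dots> = psum_perp n (monom_perp m f)"
    by (subst monom_perp_eq_fold[of ?S m f]) auto
  finally show ?thesis .
qed

lemma update_eq_add_single:
  assumes "a \<notin> Poly_Mapping.keys f"
  shows "Poly_Mapping.update a b f = f + Poly_Mapping.single a (b :: 'b :: monoid_add)"
  using assms
  by (intro poly_mapping_eqI) (auto simp: lookup_update lookup_add lookup_single when_def in_keys_iff)

lemma poly_mapping_sum_induct [case_names zero single add]: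
  fixes f :: "'a \<Rightarrow>\<^sub>0 'b :: monoid_add"
  assumes "P 0" "\<And>k c. P (Poly_Mapping.single k c)" "\<And>f g. P f \<Longrightarrow> P g \<Longrightarrow> P (f + g)"
  shows "P f"
  by (induction f rule: update_induct) (auto simp: assms update_eq_add_single)

lemma monomial_induct [case_names zero var]:
  fixes m :: "nat \<Rightarrow>\<^sub>0 nat"
  assumes "P 0" "\<And>m n. P m \<Longrightarrow> P (m + var n)"
  shows "P m"
proof (induction m rule: update_induct)
  case (update m a b)
  have "P (m + Poly_Mapping.single a k)" for k
  proof (induction k)
    case (Suc k)
    have "m + Poly_Mapping.single a (Suc k) = m + Poly_Mapping.single a k + var a"
      by (simp add: add.assoc flip: single_add)
    then show ?case
      using assms(2)[OF Suc] by metis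
  qed (use update in simp)
  with update show ?case
    by (simp add: update_eq_add_single)
qed (rule assms(1))

lemma single_add_var: "Poly_Mapping.single (m + var n) c = psum n * Poly_Mapping.single m c"
  by (simp add: psum_def mult_single add.commute)

text \<open>The polynomial ring is generated by constants and power sums, so multiplication by a
  single \<open>psum n\<close> is the only product to treat.\<close>

lemma symfun_induct [case_names const add psum]:
  fixes f :: symfun
  assumes "\<And>c. P (Poly_Mapping.single 0 c)" "\<And>f g. P f \<Longrightarrow> P g \<Longrightarrow> P (f + g)"
    "\<And>n f. P f \<Longrightarrow> P (psum n * f)"
  shows "P f"
proof (induction f rule: poly_mapping_sum_induct)
  case zero
  show ?case using assms(1)[of 0] by simp
next
  case (single m c)
  show ?case
    by (induction m rule: monomial_induct) (simp_all only: single_add_var assms)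
qed (rule assms(2))

lemma perp_const: "perp (Poly_Mapping.single 0 c) f = smul c f"
  by (simp add: perp_superset[of "{0}"] monom_perp_zero)

lemma perp_one: "perp 1 f = f"
  using perp_const[of 1 f] by simp

lemma perp_single: "perp (Poly_Mapping.single m c) f = smul c (monom_perp m f)"
  by (simp add: perp_superset[of "{m}"])

lemma perp_psum_mult: "perp (psum n * g) f = psum_perp n (perp g f)"
proof (induction g rule: poly_mapping_sum_induct)
  case (add g h)
  then show ?case
    by (simp add: distrib_left module_hom.add[OF linear_perp_left] module_hom.add[OF linear_psum_perp])
qed (simp_all add: perp_single monom_perp_add_var module_hom.scale[OF linear_psum_perp]
  module_hom.zero[OF linear_psum_perp] module_hom.zero[OF linear_perp_left] del: One_nat_def flip: single_add_var)

text \<open>Since the \<open>psum_perp n\<close> commute, substituting them for the generators is an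
  algebra homomorphism into operators.\<close>

lemma perp_mult: "perp (g * h) f = perp g (perp h f)"
proof (induction g rule: symfun_induct)
  case (const c)
  show ?case
    by (simp add: perp_const module_hom.scale[OF linear_perp_left] flip: smul_def)
next
  case (add g1 g2)
  then show ?case
    by (simp add: distrib_right module_hom.add[OF linear_perp_left])
qed (simp add: perp_psum_mult mult.assoc)

lemma linear_perp: "linear_op (perp g)"
proof (induction g rule: symfun_induct)
  case (const c)
  show ?case
    unfolding perp_const by (rule linear_op_smul)
next
  case (add g1 g2)
  then show ?case
    unfolding module_hom.add[OF linear_perp_left]
    by (intro linear_opI) (simp_all add: module_hom.add module_hom.scale symfun.scale_right_distrib)
next
  case (psum n g)
  then show ?case
    unfolding perp_psum_mult by (rule linear_op_compose[OF linear_psum_perp])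
qed

lemma perp_commute: "perp g (perp h f) = perp h (perp g f)"
  by (metis perp_mult mult.commute)

section \<open>The ring homomorphism defined by the adjoint of E(-u)\<close>

text \<open>
  The operator-valued series \<open>E\<^sup>\<bottom>(-u)\<close> as a power series in \<open>1/u\<close>; as an
  operator it is the substitution of \<open>p\<^sub>n - u\<^sup>-\<^sup>n\<close> for \<open>p\<^sub>n\<close>.
\<close>

definition shift :: "symfun \<Rightarrow> symfun fps" where
  "shift f = Abs_fps (\<lambda>c. smul ((-1) ^ c) (perp (esym c) f))"

lemma linear_shift_nth: "linear_op (\<lambda>f. shift f $ c)"
  by (simp add: shift_def linear_op_compose linear_op_smul linear_perp)

lemma smul_uminus_one_power: "(-1) ^ i * f = smul ((-1) ^ i) f"
  by (induction i) (simp_all add: smul_def single_uminus flip: mult.assoc)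

lemma of_nat_mult_smul_inverse: "of_nat (Suc n) * smul (1 / of_nat (Suc n)) f = f"
  by (simp flip: smul_of_nat del: of_nat_Suc)

lemma of_nat_Suc_mult_cancel:
  "of_nat (Suc n) * x = of_nat (Suc n) * y \<longleftrightarrow> x = (y :: symfun)"
  by (simp del: of_nat_Suc)

lemma shift_nth_0: "shift f $ 0 = f"
  by (simp add: shift_def perp_one)

text \<open>Newton's identity for \<open>esym\<close>, transported to adjoints. Together with
  \<open>shift_nth_0\<close> this recursion determines \<open>shift\<close>.\<close>

lemma shift_nth_Suc:
  "of_nat (Suc n) * shift f $ Suc n = - (\<Sum>i\<le>n. psum_perp (Suc i) (shift f $ (n - i)))"
proof -
  have sgn: "(-1) ^ Suc n * (-1) ^ i = - ((-1) ^ (n - i) :: complex)" if "i \<le> n" for i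
  proof -
    have "(-1) ^ n = (-1) ^ (n - i) * ((-1) ^ i :: complex)"
      using that by (simp flip: power_add)
    then show ?thesis by (simp add: mult.assoc flip: power_mult_distrib)
  qed
  have "of_nat (Suc n) * shift f $ Suc n =
      smul ((-1) ^ Suc n) (\<Sum>i\<le>n. perp ((-1) ^ i * psum (Suc i) * esym (n - i)) f)"
    unfolding shift_def fps_nth_Abs_fps esym.simps
    by (simp add: module_hom.scale[OF linear_perp_left] module_hom.sum[OF linear_perp_left]
        symfun.scale_left_commute[of _ "1 / _"] smul_mult_right flip: smul_of_nat del: of_nat_Suc)
  also have "\<dots> = (\<Sum>i\<le>n. smul ((-1) ^ Suc n * (-1) ^ i) (psum_perp (Suc i) (perp (esym (n - i)) f)))"
    by (simp only: mult.assoc smul_uminus_one_power smul_mult_left module_hom.scale[OF linear_perp_left]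
        perp_psum_mult symfun.scale_sum_right symfun.scale_scale)
  also have "\<dots> = - (\<Sum>i\<le>n. psum_perp (Suc i) (shift f $ (n - i)))"
    unfolding sum_negf[symmetric]
    by (intro sum.cong refl)
      (simp add: sgn shift_def module_hom.scale[OF linear_psum_perp] symfun.scale_minus_left
        del: power_Suc)
  finally show ?thesis .
qed

text \<open>The commutation of the adjoint of \<open>E(-u)\<close> with multiplication by
  \<open>p_k\<close>, by induction through the recursion of \<open>shift_nth_Suc\<close> and the
  Leibniz rule.\<close>

lemma shift_psum_mult_nth:
  "shift (psum k * f) $ c =
    psum k * shift f $ c - (if 0 < k \<and> k \<le> c then shift f $ (c - k) else 0)"
proof (induction c rule: less_induct)
  case (less c)
  show ?case
  proof (cases c)
    case 0
    then show ?thesis by (auto simp: shift_nth_0)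
  next
    case (Suc n)
    let ?s = "\<lambda>i. shift f $ i"
    have IH: "psum_perp (Suc i) (shift (psum k * f) $ (n - i)) =
        psum k * psum_perp (Suc i) (?s (n - i)) + (if Suc i = k then of_nat k * ?s (Suc n - k) else 0)
        - (if 0 < k \<and> k \<le> n - i then psum_perp (Suc i) (?s (n - k - i)) else 0)" if "i \<le> n" for i
      using that Suc
      by (subst less) (auto simp: module_hom.diff[OF linear_psum_perp] psum_perp_psum_mult
          module_hom.zero[OF linear_psum_perp] add.commute)
    have delta: "(\<Sum>i\<le>n. if Suc i = k then of_nat k * ?s (Suc n - k) else 0) =
        (if 0 < k \<and> k \<le> Suc n then of_nat k * ?s (Suc n - k) else 0)"
      by (cases k) (auto simp: sum.delta)
    have "(\<Sum>i\<le>n. if 0 < k \<and> k \<le> n - i then psum_perp (Suc i) (?s (n - k - i)) else 0) =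
        (if 0 < k \<and> k \<le> n then \<Sum>i\<le>n - k. psum_perp (Suc i) (?s (n - k - i)) else 0)"
      by (cases "0 < k \<and> k \<le> n")
        (auto intro!: sum.mono_neutral_cong_right sum.neutral split: if_splits)
    \<comment> \<open>The inner sum is the recursion for \<open>shift f\<close> at index
      \<open>n - k\<close>. For \<open>k = Suc n\<close> the factor
      \<open>of_nat (Suc n - k)\<close> is zero, so the condition can be relaxed to match
      \<open>delta\<close>.\<close>
    also have "\<dots> = (if 0 < k \<and> k \<le> Suc n then - of_nat (Suc n - k) * ?s (Suc n - k) else 0)"
    proof (cases "0 < k \<and> k \<le> n")
      case True
      then have "Suc n - k = Suc (n - k)" by (simp add: Suc_diff_le)
      with True show ?thesis
        by (simp add: shift_nth_Suc del: of_nat_Suc)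
    qed (cases "k = Suc n"; auto)
    finally have third: "(\<Sum>i\<le>n. if 0 < k \<and> k \<le> n - i then psum_perp (Suc i) (?s (n - k - i)) else 0) =
        (if 0 < k \<and> k \<le> Suc n then - of_nat (Suc n - k) * ?s (Suc n - k) else 0)" .
    have "of_nat (Suc n) * shift (psum k * f) $ Suc n =
        psum k * (of_nat (Suc n) * ?s (Suc n)) -
        (if 0 < k \<and> k \<le> Suc n then (of_nat k + of_nat (Suc n - k)) * ?s (Suc n - k) else 0)"
      unfolding shift_nth_Suc
      by (simp add: IH sum.distrib sum_subtractf delta third flip: sum_distrib_left del: of_nat_Suc)
        (simp add: algebra_simps)
    \<comment> \<open>The weights \<open>k\<close> and \<open>Suc n - k\<close> add up to
      \<open>Suc n\<close>, which then cancels.\<close>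
    also have "\<dots> = of_nat (Suc n) * (psum k * ?s (Suc n) -
        (if 0 < k \<and> k \<le> Suc n then ?s (Suc n - k) else 0))"
      by (auto simp: right_diff_distrib mult_ac simp flip: of_nat_add)
    finally show ?thesis
      unfolding of_nat_Suc_mult_cancel Suc .
  qed
qed

lemma shift_zero: "shift 0 = 0"
  by (rule fps_ext) (simp add: module_hom.zero[OF linear_shift_nth])

lemma shift_add: "shift (f + g) = shift f + shift g"
  by (rule fps_ext) (simp add: module_hom.add[OF linear_shift_nth])

lemma shift_minus: "shift (- f) = - shift f"
  by (rule fps_ext) (simp add: module_hom.neg[OF linear_shift_nth])

lemma shift_sum: "shift (sum f I) = (\<Sum>i\<in>I. shift (f i))"
  by (rule fps_ext) (simp add: module_hom.sum[OF linear_shift_nth] fps_sum_nth)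

lemma shift_psum_mult:
  "shift (psum k * f) = (fps_const (psum k) - (if k = 0 then 0 else fps_X ^ k)) * shift f"
  by (rule fps_ext) (auto simp: shift_psum_mult_nth left_diff_distrib fps_X_power_mult_nth)

lemma psum_perp_one: "psum_perp n 1 = 0"
  by (rule poly_mapping_eqI)
    (auto simp: lookup_psum_perp lookup_one when_def dest: arg_cong[of _ _ "\<lambda>m. lk m n"]
      simp: lookup_add)

lemma shift_one: "shift 1 = 1"
proof -
  have "shift 1 $ c = (if c = 0 then 1 else 0)" for c
  proof (induction c rule: less_induct)
    case (less c)
    show ?case
    proof (cases c)
      case (Suc n)
      have "of_nat (Suc n) * shift 1 $ Suc n = of_nat (Suc n) * 0"
        unfolding shift_nth_Suc
        by (auto simp: less Suc psum_perp_one module_hom.zero[OF linear_psum_perp] intro!: sum.neutral)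
      then show ?thesis
        unfolding of_nat_Suc_mult_cancel by (simp add: Suc)
    qed (simp add: shift_nth_0)
  qed
  then show ?thesis
    by (intro fps_ext) simp
qed

lemma shift_const_mult:
  "shift (Poly_Mapping.single 0 c * f) = fps_const (Poly_Mapping.single 0 c) * shift f"
  unfolding smul_def[symmetric]
  by (rule fps_ext) (simp add: module_hom.scale[OF linear_shift_nth], simp add: smul_def)

lemma shift_const: "shift (Poly_Mapping.single 0 c) = fps_const (Poly_Mapping.single 0 c)"
  using shift_const_mult[of c 1] by (simp add: shift_one)

text \<open>By \<open>shift_psum_mult\<close>, a factor \<open>psum k\<close> turns into a factor
  that does not depend on \<open>f\<close>; induction on generators gives multiplicativity.\<close>

lemma shift_mult: "shift (f * g) = shift f * shift g"
  by (induction f rule: symfun_induct)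
    (simp_all add: shift_const_mult shift_const shift_add shift_psum_mult distrib_right mult.assoc)

lemma shift_of_nat: "shift (of_nat n) = of_nat n"
  using shift_const[of "of_nat n"] by (simp add: fps_of_nat)

lemma shift_psum: "n > 0 \<Longrightarrow> shift (psum n) = fps_const (psum n) - fps_X ^ n"
  using shift_psum_mult[of n 1] by (simp add: shift_one)

lemma shift_eventually_zero: "\<exists>B. \<forall>c>B. shift f $ c = 0"
proof (induction f rule: symfun_induct)
  case (const c)
  show ?case by (auto simp: shift_const intro!: exI[of _ 0])
next
  case (add f g)
  then obtain B C where "\<forall>c>B. shift f $ c = 0" "\<forall>c>C. shift g $ c = 0" by auto
  then show ?case
    by (auto simp: shift_add intro!: exI[of _ "max B C"])
next
  case (psum n f)
  then obtain B where "\<forall>c>B. shift f $ c = 0" by auto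
  then show ?case
    by (auto simp: shift_psum_mult_nth intro!: exI[of _ "B + n"])
qed

section \<open>Generating functions\<close>

text \<open>The substitution of \<open>-v\<close> for the variable \<open>v\<close>.\<close>

definition twist :: "'a :: comm_ring_1 fps \<Rightarrow> 'a fps" where
  "twist F = Abs_fps (\<lambda>n. (-1) ^ n * F $ n)"

lemma twist_mult: "twist (F * G) = twist F * twist G"
proof (rule fps_ext)
  fix n
  have *: "(-1) ^ n = (-1) ^ i * (-1 :: 'a) ^ (n - i)" if "i \<le> n" for i
    using that by (simp flip: power_add)
  show "twist (F * G) $ n = (twist F * twist G) $ n"
    unfolding twist_def fps_mult_nth fps_nth_Abs_fps sum_distrib_left
    by (intro sum.cong refl, subst *) (auto simp: mult_ac)
qed

lemma twist_twist: "twist (twist F) = F"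
  by (rule fps_ext) (simp add: twist_def flip: mult.assoc power_mult_distrib)

lemma twist_one: "twist 1 = 1"
  by (rule fps_ext) (simp add: twist_def)

lemma fps_deriv_twist: "fps_deriv (twist F) = - twist (fps_deriv F)"
  by (rule fps_ext) (simp add: twist_def mult_ac)

text \<open>The equation expresses \<open>Suc k\<close> times coefficient \<open>Suc k\<close> by
  lower ones. Generating functions can thus be compared through logarithmic derivatives, without
  exponentials.\<close>

lemma fps_linear_ode_unique:
  fixes F G P :: "'a :: {idom, semiring_char_0} fps"
  assumes "fps_deriv F = P * F" "fps_deriv G = P * G" "F $ 0 = G $ 0"
  shows "F = G"
proof -
  have "F $ n = G $ n" for n
  proof (induction n rule: less_induct)
    case (less n)
    show ?case
    proof (cases n)
      case (Suc k)
      have "of_nat (Suc k) * F $ Suc k = (P * F) $ k" and "of_nat (Suc k) * G $ Suc k = (P * G) $ k"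
        by (simp_all flip: assms(1,2))
      moreover have "(P * F) $ k = (P * G) $ k"
        unfolding fps_mult_nth using less Suc by (intro sum.cong) auto
      ultimately show ?thesis
        unfolding Suc by (metis mult_cancel_left of_nat_eq_0_iff nat.distinct(1))
    qed (use assms(3) in simp)
  qed
  then show ?thesis by (rule fps_ext)
qed

definition Hgen :: "symfun fps" where "Hgen = Abs_fps hsym"
definition Egen :: "symfun fps" where "Egen = Abs_fps esym"
text \<open>The logarithmic derivative of \<open>H\<close>, whence the shift of the index by
  one.\<close>

definition Pgen :: "symfun fps" where "Pgen = Abs_fps (\<lambda>i. psum (Suc i))"

lemma fps_deriv_Hgen: "fps_deriv Hgen = Pgen * Hgen"
  by (rule fps_ext)
    (simp add: Hgen_def Pgen_def fps_mult_nth of_nat_mult_smul_inverse atLeast0AtMost del: of_nat_Suc)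

lemma fps_deriv_Egen: "fps_deriv Egen = twist Pgen * Egen"
  by (rule fps_ext)
    (simp add: Egen_def Pgen_def twist_def fps_mult_nth of_nat_mult_smul_inverse atLeast0AtMost
      del: of_nat_Suc)

text \<open>The logarithmic derivatives of \<open>E(-v)\<close> and \<open>H(v)\<close> are
  opposite, so the product is constant.\<close>

lemma twist_Egen_mult_Hgen: "twist Egen * Hgen = 1"
proof (rule fps_linear_ode_unique[where P = 0])
  show "fps_deriv (twist Egen * Hgen) = 0 * (twist Egen * Hgen)"
    by (simp add: fps_deriv_twist fps_deriv_Egen fps_deriv_Hgen twist_mult twist_twist mult_ac)
qed (simp_all add: twist_def Egen_def Hgen_def)

definition Qgen :: "symfun fps" where "Qgen = Egen * Hgen"

lemma twist_Qgen_mult_Qgen: "twist Qgen * Qgen = 1"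
proof -
  have "twist Qgen * Qgen = (twist Egen * Hgen) * twist (twist Egen * Hgen)"
    by (simp add: Qgen_def twist_mult twist_twist mult_ac)
  then show ?thesis
    by (simp only: twist_Egen_mult_Hgen twist_one mult_1)
qed

section \<open>Coefficientwise extension to series in two variables\<close>

definition shift_coeffs :: "symfun fps \<Rightarrow> symfun fps fps" where
  "shift_coeffs F = Abs_fps (\<lambda>n. shift (F $ n))"

text \<open>The embedding of series that do not involve \<open>u\<close>, with which the images
  under \<open>shift_coeffs\<close> are compared.\<close>

definition const_coeffs :: "'a :: comm_ring_1 fps \<Rightarrow> 'a fps fps" where
  "const_coeffs F = Abs_fps (\<lambda>n. fps_const (F $ n))"

lemma shift_coeffs_mult: "shift_coeffs (F * G) = shift_coeffs F * shift_coeffs G"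
  by (rule fps_ext) (simp add: shift_coeffs_def fps_mult_nth shift_sum shift_mult)

lemma fps_const_sum: "fps_const (sum f I) = (\<Sum>i\<in>I. fps_const (f i))"
  by (rule fps_ext) (simp add: fps_sum_nth)

lemma const_coeffs_mult: "const_coeffs (F * G) = const_coeffs F * const_coeffs G"
  by (rule fps_ext) (simp add: const_coeffs_def fps_mult_nth fps_const_sum flip: fps_const_mult)

lemma fps_deriv_shift_coeffs: "fps_deriv (shift_coeffs F) = shift_coeffs (fps_deriv F)"
  by (rule fps_ext) (simp add: shift_coeffs_def shift_mult shift_of_nat del: of_nat_Suc)

lemma fps_deriv_const_coeffs: "fps_deriv (const_coeffs F) = const_coeffs (fps_deriv F)"
  by (rule fps_ext) (simp add: const_coeffs_def fps_of_nat[symmetric] flip: fps_const_mult del: of_nat_Suc)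

lemma shift_coeffs_twist: "shift_coeffs (twist F) = twist (shift_coeffs F)"
proof -
  have "shift ((-1) ^ n * f) = (-1) ^ n * shift f" for n f
    by (induction n) (simp_all add: shift_minus)
  then show ?thesis
    by (intro fps_ext) (simp add: shift_coeffs_def twist_def)
qed

lemma const_coeffs_twist: "const_coeffs (twist F) = twist (const_coeffs F)"
proof -
  have "fps_const ((-1) ^ n * f) = (-1) ^ n * fps_const f" for n and f :: 'a
    by (induction n) (simp_all flip: fps_const_neg)
  then show ?thesis
    by (intro fps_ext) (simp add: const_coeffs_def twist_def)
qed

text \<open>
  In a series over series the outer variable is \<open>v\<close>, in which the generating functions are
  written, and the inner one is \<open>1/u\<close>; thus \<open>YX\<close> is \<open>v/u\<close>, and \<open>geo\<close> is what \<open>shift\<close> subtracts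
  from the series of power sums.
\<close>

definition geo :: "'a :: comm_ring_1 fps fps" where
  "geo = Abs_fps (\<lambda>i. fps_X ^ Suc i)"

abbreviation YX :: "'a :: comm_ring_1 fps fps" where
  "YX \<equiv> fps_const fps_X * fps_X"

text \<open>\<open>geo\<close> is the geometric series of \<open>(1/u) / (1 - v/u)\<close>.\<close>

lemma one_minus_YX_mult_geo: "(1 - YX) * geo = fps_const fps_X"
  by (rule fps_ext) (auto simp: geo_def left_diff_distrib mult.assoc gr0_conv_Suc)

lemma twist_YX: "twist YX = - YX"
  by (rule fps_ext) (auto simp: twist_def le_Suc_eq)

lemma twist_diff: "twist (F - G) = twist F - twist G"
  by (rule fps_ext) (simp add: twist_def right_diff_distrib)

lemma twist_fps_const: "twist (fps_const a) = fps_const a"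
  by (rule fps_ext) (simp add: twist_def)

lemma one_plus_YX_mult_twist_geo: "(1 + YX) * twist geo = fps_const fps_X"
  using arg_cong[OF one_minus_YX_mult_geo, of twist]
  by (simp only: twist_mult[of "1 - YX"] twist_diff twist_one twist_YX twist_fps_const diff_minus_eq_add)

lemma shift_coeffs_Pgen: "shift_coeffs Pgen = const_coeffs Pgen - geo"
  by (rule fps_ext) (simp add: shift_coeffs_def const_coeffs_def Pgen_def geo_def shift_psum)

text \<open>Subtracting \<open>geo\<close> from the logarithmic derivative multiplies
  \<open>H(v)\<close> by \<open>1 - v/u\<close>, because \<open>- geo\<close> is the logarithmic
  derivative of that factor.\<close>

lemma shift_coeffs_Hgen: "shift_coeffs Hgen = (1 - YX) * const_coeffs Hgen"
proof (rule fps_linear_ode_unique[where P = "const_coeffs Pgen - geo"])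
  show "fps_deriv (shift_coeffs Hgen) = (const_coeffs Pgen - geo) * shift_coeffs Hgen"
    by (simp add: fps_deriv_shift_coeffs fps_deriv_Hgen shift_coeffs_mult shift_coeffs_Pgen)
  have "fps_deriv ((1 - YX) * const_coeffs Hgen) =
      (1 - YX) * fps_deriv (const_coeffs Hgen) - fps_const fps_X * const_coeffs Hgen"
    by (simp flip: fps_const_neg)
  also have "\<dots> = (1 - YX) * (const_coeffs Pgen * const_coeffs Hgen) -
      ((1 - YX) * geo) * const_coeffs Hgen"
    by (simp only: fps_deriv_const_coeffs fps_deriv_Hgen const_coeffs_mult one_minus_YX_mult_geo)
  also have "\<dots> = (const_coeffs Pgen - geo) * ((1 - YX) * const_coeffs Hgen)"
    by (simp only: algebra_simps)
  finally show "fps_deriv ((1 - YX) * const_coeffs Hgen) =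
    (const_coeffs Pgen - geo) * ((1 - YX) * const_coeffs Hgen)" .
qed (simp add: shift_coeffs_def const_coeffs_def Hgen_def shift_one)

lemma shift_coeffs_Egen: "(1 + YX) * shift_coeffs Egen = const_coeffs Egen"
proof (rule fps_linear_ode_unique[where P = "const_coeffs (twist Pgen)"])
  have "fps_deriv (shift_coeffs Egen) = (const_coeffs (twist Pgen) - twist geo) * shift_coeffs Egen"
    by (simp only: fps_deriv_shift_coeffs fps_deriv_Egen shift_coeffs_mult shift_coeffs_Pgen
        shift_coeffs_twist const_coeffs_twist twist_diff)
  moreover have "fps_deriv ((1 + YX) * shift_coeffs Egen) =
      (1 + YX) * fps_deriv (shift_coeffs Egen) + fps_const fps_X * shift_coeffs Egen"
    by simp
  ultimately have "fps_deriv ((1 + YX) * shift_coeffs Egen) = ((1 + YX) * const_coeffs (twist Pgen)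
      - (1 + YX) * twist geo + fps_const fps_X) * shift_coeffs Egen"
    by (simp only: right_diff_distrib left_diff_distrib distrib_right mult.assoc)
  also have "\<dots> = const_coeffs (twist Pgen) * ((1 + YX) * shift_coeffs Egen)"
    unfolding one_plus_YX_mult_twist_geo by (simp add: mult_ac)
  finally show "fps_deriv ((1 + YX) * shift_coeffs Egen) =
    const_coeffs (twist Pgen) * ((1 + YX) * shift_coeffs Egen)" .
next
  show "fps_deriv (const_coeffs Egen) = const_coeffs (twist Pgen) * const_coeffs Egen"
    by (simp only: fps_deriv_const_coeffs fps_deriv_Egen const_coeffs_mult)
qed (simp add: shift_coeffs_def const_coeffs_def Egen_def shift_one)

lemma shift_coeffs_Qgen: "(1 + YX) * shift_coeffs Qgen = (1 - YX) * const_coeffs Qgen"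
  unfolding Qgen_def shift_coeffs_mult const_coeffs_mult shift_coeffs_Hgen
    shift_coeffs_Egen[symmetric] by (simp only: mult_ac)

text \<open>The sign \<open>(-1)^k\<close> for integers \<open>k\<close>, usable in rings such as
  \<open>symfun\<close> that are not fields.\<close>

definition sgn_parity :: "int \<Rightarrow> 'a :: comm_ring_1" where
  "sgn_parity k = (if even k then 1 else -1)"

text \<open>
  \<open>contraction k\<close> is the coefficient of \<open>x\<^sup>k\<close> in \<open>(1 - x)/(1 + x)\<close>, where \<open>x = v/u\<close>.
\<close>

definition contraction :: "nat \<Rightarrow> 'a :: comm_ring_1" where
  "contraction k = (if k = 0 then 1 else 2 * sgn_parity (int k))"

text \<open>Comparing coefficients of \<open>v\<close> in \<open>shift_coeffs_Qgen\<close> gives a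
  recursion in \<open>n\<close>, solved by the expansion of \<open>(1 - x)/(1 + x)\<close>.\<close>

lemma shift_Qgen_nth:
  "shift (Qgen $ n) $ a = (if a \<le> n then contraction a * Qgen $ (n - a) else 0)"
proof (induction n arbitrary: a)
  case 0
  have "Qgen $ 0 = 1" by (simp add: Qgen_def Egen_def Hgen_def)
  then show ?case by (simp add: shift_one contraction_def)
next
  case (Suc n)
  have "((1 + YX) * shift_coeffs Qgen) $ Suc n = ((1 - YX) * const_coeffs Qgen) $ Suc n"
    by (simp only: shift_coeffs_Qgen)
  then have rec: "shift (Qgen $ Suc n) =
      fps_const (Qgen $ Suc n) - fps_X * fps_const (Qgen $ n) - fps_X * shift (Qgen $ n)"
    by (simp add: shift_coeffs_def const_coeffs_def distrib_right left_diff_distrib mult.assoc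
        algebra_simps)
  show ?case
    by (cases a) (auto simp: rec Suc contraction_def sgn_parity_def)
qed

section \<open>Modes of the neutral fermion field\<close>

text \<open>Extension by zero to negative indices lets sums run over arbitrary integer
  ranges.\<close>

definition Qcoeff :: "int \<Rightarrow> symfun" where
  "Qcoeff i = (if i < 0 then 0 else Qgen $ nat i)"

lemma shift_Qcoeff_nth: "shift (Qcoeff i) $ a = contraction a * Qcoeff (i - int a)"
  by (auto simp: Qcoeff_def shift_zero shift_Qgen_nth nat_diff_distrib' nat_le_iff le_nat_iff)

lemma sgn_parity_of_nat: "sgn_parity (int n) = (-1) ^ n"
  and sgn_parity_uminus: "sgn_parity (- a) = sgn_parity a"
  by (auto simp: sgn_parity_def)

text \<open>This is the coefficient of \<open>v^L\<close> in \<open>Q(-v) Q(v) = 1\<close>; indices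
  outside \<open>{0..L}\<close> contribute zero.\<close>

lemma sum_Qcoeff_alternating:
  assumes "finite S" "{0..L} \<subseteq> S"
  shows "(\<Sum>s\<in>S. sgn_parity s * (Qcoeff s * Qcoeff (L - s))) = (if L = 0 then 1 else 0)"
proof -
  have "(\<Sum>s\<in>S. sgn_parity s * (Qcoeff s * Qcoeff (L - s))) =
      (\<Sum>s\<in>{0..L}. sgn_parity s * (Qcoeff s * Qcoeff (L - s)))"
    using assms by (intro sum.mono_neutral_right) (auto simp: Qcoeff_def)
  also have "\<dots> = (if L = 0 then 1 else 0)"
  proof (cases "L < 0")
    case False
    then obtain n where n: "L = int n"
      by (metis nat_0_le not_less)
    have "(\<Sum>s\<in>{0..L}. sgn_parity s * (Qcoeff s * Qcoeff (L - s))) = (twist Qgen * Qgen) $ n"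
      unfolding fps_mult_nth
      by (rule sum.reindex_bij_witness[of _ int nat])
        (auto simp: n Qcoeff_def twist_def nat_diff_distrib' mult.assoc simp flip: sgn_parity_of_nat)
    then show ?thesis
      by (simp add: twist_Qgen_mult_Qgen n)
  qed auto
  finally show ?thesis .
qed

lemma sum_esym_hsym_eq_Qcoeff:
  assumes "i \<le> int K"
  shows "(\<Sum>a\<le>K. \<Sum>b\<le>K. if int a + int b = i then esym a * hsym b else 0) = Qcoeff i"
proof (cases "i < 0")
  case False
  then obtain n where n: "i = int n"
    by (metis nat_0_le not_less)
  have "(\<Sum>b\<le>K. if int a + int b = i then esym a * hsym b else 0) =
      (if a \<le> n then esym a * hsym (n - a) else 0)" for a
  proof -
    have "(\<Sum>b\<le>K. if int a + int b = i then esym a * hsym b else 0) =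
        (\<Sum>b\<le>K. if b = n - a then if a \<le> n then esym a * hsym b else 0 else 0)"
      by (rule sum.cong) (auto simp: n)
    also have "\<dots> = (if a \<le> n then esym a * hsym (n - a) else 0)"
      using assms by (auto simp: n)
    finally show ?thesis .
  qed
  then have "(\<Sum>a\<le>K. \<Sum>b\<le>K. if int a + int b = i then esym a * hsym b else 0) =
      (\<Sum>a\<le>K. if a \<le> n then esym a * hsym (n - a) else 0)"
    by simp
  also have "\<dots> = (\<Sum>a\<in>{0..n}. esym a * hsym (n - a))"
    using assms by (intro sum.mono_neutral_cong_right) (auto simp: n)
  finally show ?thesis
    by (simp add: n Qcoeff_def Qgen_def fps_mult_nth Egen_def Hgen_def)
qed (auto simp: Qcoeff_def intro!: sum.neutral)

text \<open>For fixed \<open>c\<close> the sum over \<open>a\<close> and \<open>b\<close> is the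
  coefficient of \<open>u^(c - j)\<close> in \<open>E(u) H(u)\<close>.\<close>

lemma phi_eq_sum:
  assumes "\<forall>c>B. shift f $ c = 0"
  shows "phi j f = (\<Sum>c\<le>B. Qcoeff (int c - j) * shift f $ c)"
proof -
  \<comment> \<open>Nonzero terms have \<open>a + b = c - j \<le> B - j\<close>, so \<open>K\<close>
    bounds both \<open>a\<close> and \<open>b\<close>.\<close>
  define K where "K = nat (int B - j)"
  define g where "g = (\<lambda>(a, b, c). if int a + int b = int c - j
      then esym a * hsym b * shift f $ c else 0)"
  have eq: "(if int a + int b - int c = - j then (-1) ^ c * esym a * hsym b * perp (esym c) f else 0) =
      g (a, b, c)" for a b c
    by (auto simp: g_def shift_def mult_ac simp flip: smul_uminus_one_power)
  have "phi j f = Sum_any g"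
    unfolding phi_def by (rule Sum_any.cong) (auto simp: eq)
  also have "\<dots> = sum g ({..K} \<times> {..K} \<times> {..B})"
  proof (rule Sum_any.expand_superset)
    show "{x. g x \<noteq> 0} \<subseteq> {..K} \<times> {..K} \<times> {..B}"
      using assms by (fastforce simp: g_def K_def split: if_splits simp: not_less[symmetric])
  qed auto
  also have "\<dots> = (\<Sum>a\<le>K. \<Sum>b\<le>K. \<Sum>c\<le>B. g (a, b, c))"
    by (simp add: sum.cartesian_product)
  also have "\<dots> = (\<Sum>a\<le>K. \<Sum>c\<le>B. \<Sum>b\<le>K. g (a, b, c))"
    by (intro sum.cong refl sum.swap)
  also have "\<dots> = (\<Sum>c\<le>B. \<Sum>a\<le>K. \<Sum>b\<le>K. g (a, b, c))"
    by (rule sum.swap)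
  also have "\<dots> = (\<Sum>c\<le>B. Qcoeff (int c - j) * shift f $ c)"
  proof (intro sum.cong refl)
    fix c assume "c \<in> {..B}"
    then have le: "int c - j \<le> int K"
      by (auto simp: K_def)
    show "(\<Sum>a\<le>K. \<Sum>b\<le>K. g (a, b, c)) = Qcoeff (int c - j) * shift f $ c"
      unfolding sum_esym_hsym_eq_Qcoeff[OF le, symmetric] sum_distrib_right
      by (intro sum.cong refl) (simp add: g_def)
  qed
  finally show ?thesis .
qed

lemma linear_phi: "linear_op (phi j)"
proof (rule linear_opI)
  fix f g c
  obtain B where B: "\<forall>c>B. shift f $ c = 0"
    using shift_eventually_zero by blast
  obtain C where C: "\<forall>c>C. shift g $ c = 0"
    using shift_eventually_zero by blast
  have "\<forall>c>max B C. shift f $ c = 0" "\<forall>c>max B C. shift g $ c = 0" "\<forall>c>max B C. shift (f + g) $ c = 0"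
    using B C by (auto simp: shift_add)
  then show "phi j (f + g) = phi j f + phi j g"
    by (simp add: phi_eq_sum[of "max B C"] shift_add distrib_left sum.distrib)
  have "\<forall>d>B. shift (smul c f) $ d = 0"
    using B by (simp add: module_hom.scale[OF linear_shift_nth])
  with B show "phi j (smul c f) = smul c (phi j f)"
    by (simp add: phi_eq_sum[of B] module_hom.scale[OF linear_shift_nth] smul_mult_right
        symfun.scale_sum_right)
qed

lemma phi_eventually_zero: "\<exists>N. \<forall>j>N. phi j f = 0"
proof -
  obtain B where "\<forall>c>B. shift f $ c = 0"
    using shift_eventually_zero by blast
  then have "phi j f = 0" if "j > int B" for j
    using that by (auto simp: phi_eq_sum[of B] Qcoeff_def intro!: sum.neutral)
  then show ?thesis by blast
qed

section \<open>Adjoint operators on odd symmetric functions\<close>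

lemma psum_perp_eq_zero:
  assumes "f \<in> B_odd" "even n"
  shows "psum_perp n f = 0"
proof -
  have "lk m n = 0" if "m \<in> Poly_Mapping.keys f" for m
    using assms that unfolding B_odd_def by (metis (no_types, lifting) in_keys_iff mem_Collect_eq)
  then show ?thesis
    by (simp add: psum_perp_def)
qed

lemma psum_perp_perp: "psum_perp n (perp g f) = perp g (psum_perp n f)"
  using perp_commute[of "psum n * 1" g f] by (simp only: perp_psum_mult perp_one)

text \<open>The Newton identities for \<open>e\<close> and \<open>h\<close> differ only in the signs
  of the even power sums, whose adjoints vanish on \<open>B_odd\<close>.\<close>

lemma perp_esym_eq_perp_hsym:
  assumes "f \<in> B_odd"
  shows "perp (esym n) f = perp (hsym n) f"
proof (induction n rule: less_induct)
  case (less n)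
  show ?case
  proof (cases n)
    case (Suc k)
    have "perp ((-1) ^ i * psum (Suc i) * esym (k - i)) f = perp (psum (Suc i) * hsym (k - i)) f"
      if "i \<le> k" for i
    proof (cases "even i")
      case False
      \<comment> \<open>By \<open>psum_perp_perp\<close> the derivative can act on \<open>f\<close>
        first, so invariance of \<open>B_odd\<close> under \<open>perp\<close> need not be
        shown.\<close>
      then have "psum_perp (Suc i) f = 0"
        using assms by (intro psum_perp_eq_zero) auto
      then show ?thesis
        by (simp only: mult.assoc smul_uminus_one_power smul_mult_left module_hom.scale[OF linear_perp_left]
            perp_psum_mult psum_perp_perp module_hom.zero[OF linear_perp] symfun.scale_zero_right)
    qed (use less that Suc in \<open>simp add: perp_psum_mult\<close>)
    then show ?thesis
      by (simp add: Suc module_hom.scale[OF linear_perp_left] module_hom.sum[OF linear_perp_left])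
  qed simp
qed

text \<open>The coefficient of \<open>u^(-c) v^(-d)\<close> in the product of the adjoints of
  \<open>E(-u)\<close> and \<open>E(-v)\<close>, applied to \<open>f\<close>.\<close>

definition shift2 :: "symfun \<Rightarrow> nat \<Rightarrow> nat \<Rightarrow> symfun" where
  "shift2 f c d = shift (shift f $ d) $ c"

lemma shift2_eq: "shift2 f c d = smul ((-1) ^ (c + d)) (perp (esym c) (perp (esym d) f))"
  by (simp add: shift2_def shift_def module_hom.scale[OF linear_perp] power_add)

lemma shift2_commute: "shift2 f c d = shift2 f d c"
  by (simp add: shift2_eq perp_commute add.commute)

lemma shift2_eq_zero:
  assumes "\<forall>c>B. shift f $ c = 0" "c > B \<or> d > B"
  shows "shift2 f c d = 0"
  using assms shift2_commute[of f c d]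
  by (auto simp: shift2_def module_hom.zero[OF linear_shift_nth])

text \<open>At \<open>v = -u\<close> the two adjoints cancel on \<open>B_odd\<close>: one
  \<open>E\<close> may be replaced by \<open>H\<close> there, and
  \<open>E(-u) H(u) = 1\<close>.\<close>

lemma sum_shift2_alternating:
  assumes "f \<in> B_odd"
  shows "(\<Sum>c\<le>n. sgn_parity (int c) * shift2 f c (n - c)) = (if n = 0 then f else 0)"
proof -
  have "(\<Sum>c\<le>n. sgn_parity (int c) * shift2 f c (n - c)) =
      (\<Sum>c\<le>n. (-1) ^ n * perp ((-1) ^ c * (esym c * hsym (n - c))) f)"
    by (intro sum.cong refl)
      (simp add: shift2_eq sgn_parity_of_nat smul_uminus_one_power perp_mult
        perp_esym_eq_perp_hsym[OF assms] module_hom.scale[OF linear_perp_left] mult.commute)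
  also have "\<dots> = (-1) ^ n * perp ((twist Egen * Hgen) $ n) f"
    by (simp add: fps_mult_nth twist_def Egen_def Hgen_def module_hom.sum[OF linear_perp_left]
        sum_distrib_left atLeast0AtMost mult.assoc)
  also have "\<dots> = (if n = 0 then f else 0)"
    by (simp add: twist_Egen_mult_Hgen perp_one module_hom.zero[OF linear_perp_left])
  finally show ?thesis .
qed

section \<open>The anticommutation relations\<close>

text \<open>
  The coefficient of \<open>u\<^sup>M v\<^sup>N\<close> in \<open>E(u) H(u) E(v) H(v) E\<^sup>\<bottom>(-u) E\<^sup>\<bottom>(-v) f\<close>, the normally ordered product,
  if \<open>B\<close> is at least the degree of \<open>f\<close>.
\<close>

definition pair_sum :: "symfun \<Rightarrow> nat \<Rightarrow> int \<Rightarrow> int \<Rightarrow> symfun" where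
  "pair_sum f B M N =
    (\<Sum>c\<le>B. \<Sum>d\<le>B. Qcoeff (M + int c) * Qcoeff (N + int d) * shift2 f c d)"

lemma pair_sum_commute: "pair_sum f B M N = pair_sum f B N M"
  unfolding pair_sum_def
  by (subst sum.swap) (simp add: mult_ac shift2_commute[of f])

text \<open>Moving the adjoint of \<open>E(-u)\<close> past \<open>Q(v)\<close> produces
  \<open>(1 - v/u)/(1 + v/u)\<close>; its term in \<open>(v/u)^k\<close> moves the exponents of
  \<open>u\<close> and \<open>v\<close> by \<open>k\<close> in opposite directions.\<close>

lemma phi_phi_eq_sum:
  assumes B: "\<forall>c>B. shift f $ c = 0" and K: "int B - n \<le> int K"
  shows "phi m (phi n f) = (\<Sum>k\<le>K. contraction k * pair_sum f B (int k - m) (- n - int k))"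
proof -
  obtain C0 where C0: "\<forall>c>C0. shift (phi n f) $ c = 0"
    using shift_eventually_zero by blast
  \<comment> \<open>Besides covering \<open>shift (phi n f)\<close>, \<open>C\<close> must make the
    triangle \<open>k + c \<le> C\<close> contain the box
    \<open>{..K} \<times> {..B}\<close>.\<close>
  define C where "C = max C0 (B + K)"
  define g where "g = (\<lambda>d k c. contraction k * (Qcoeff (int c + int k - m) *
    Qcoeff (int d - n - int k) * shift2 f c d))"
  have "shift (phi n f) $ c = (\<Sum>d\<le>B. \<Sum>k\<le>c.
      contraction k * Qcoeff (int d - n - int k) * shift2 f (c - k) d)" for c
    by (simp add: phi_eq_sum[OF B] shift_sum shift_mult fps_sum_nth fps_mult_nth shift_Qcoeff_nth
        atLeast0AtMost shift2_def)
  then have "phi m (phi n f) = (\<Sum>c\<le>C. \<Sum>d\<le>B. \<Sum>k\<le>c. g d k (c - k))"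
    using C0
    by (subst phi_eq_sum[of C])
      (auto simp: C_def g_def sum_distrib_left mult_ac intro!: sum.cong)
  also have "\<dots> = (\<Sum>d\<le>B. \<Sum>c\<le>C. \<Sum>k\<le>c. g d k (c - k))"
    by (rule sum.swap)
  also have "\<dots> = (\<Sum>d\<le>B. \<Sum>k\<le>K. \<Sum>c\<le>B. g d k c)"
  proof (rule sum.cong[OF refl])
    fix d assume d: "d \<in> {..B}"
    have fin: "finite {(k, c). k + c \<le> C}"
      by (rule finite_subset[of _ "{..C} \<times> {..C}"]) auto
    have "(\<Sum>c\<le>C. \<Sum>k\<le>c. g d k (c - k)) = (\<Sum>(k, c)\<in>{(k, c). k + c \<le> C}. g d k c)"
      by (rule sum.triangle_reindex_eq[symmetric])
    also have "\<dots> = (\<Sum>(k, c)\<in>{..K} \<times> {..B}. g d k c)"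
    proof (rule sum.mono_neutral_right[OF fin])
      show "\<forall>p\<in>{(k, c). k + c \<le> C} - {..K} \<times> {..B}. (case p of (k, c) \<Rightarrow> g d k c) = 0"
      proof
        fix p assume p: "p \<in> {(k, c). k + c \<le> C} - {..K} \<times> {..B}"
        obtain k c where kc: "p = (k, c)" by fastforce
        with p consider "k > K" | "c > B" by fastforce
        then show "(case p of (k, c) \<Rightarrow> g d k c) = 0"
        proof cases
          case 1
          then have "Qcoeff (int d - n - int k) = 0"
            using K d by (simp add: Qcoeff_def)
          then show ?thesis by (simp add: kc g_def)
        qed (simp add: kc g_def shift2_eq_zero[OF B])
      qed
    qed (auto simp: C_def)
    finally show "(\<Sum>c\<le>C. \<Sum>k\<le>c. g d k (c - k)) = (\<Sum>k\<le>K. \<Sum>c\<le>B. g d k c)"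
      by (simp add: sum.cartesian_product)
  qed
  also have "\<dots> = (\<Sum>k\<le>K. \<Sum>d\<le>B. \<Sum>c\<le>B. g d k c)"
    by (rule sum.swap)
  also have "\<dots> = (\<Sum>k\<le>K. \<Sum>c\<le>B. \<Sum>d\<le>B. g d k c)"
    by (intro sum.cong refl sum.swap)
  finally show ?thesis
    by (simp add: g_def pair_sum_def sum_distrib_left algebra_simps)
qed

text \<open>The expansions of \<open>(1 - x)/(1 + x)\<close> in \<open>x\<close> and of its
  counterpart in \<open>1/x\<close> add up to twice the sum of \<open>(-x)^k\<close> over all
  integers, the delta function at \<open>x = -1\<close>. For \<open>k = 0\<close> the factor 2 comes
  from counting \<open>F 0\<close> twice.\<close>

lemma sum_contraction_symmetric:
  fixes F :: "int \<Rightarrow> 'a :: comm_ring_1"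
  shows "(\<Sum>k\<le>K. contraction k * (F (int k) + F (- int k))) =
    2 * (\<Sum>k\<in>{- int K..int K}. sgn_parity k * F k)"
proof (induction K)
  case 0
  show ?case by (simp add: contraction_def sgn_parity_def)
next
  case (Suc K)
  have "{- int (Suc K)..int (Suc K)} = insert (int (Suc K)) (insert (- int (Suc K)) {- int K..int K})"
    by auto
  then have "(\<Sum>k\<in>{- int (Suc K)..int (Suc K)}. sgn_parity k * F k) =
      (\<Sum>k\<in>{- int K..int K}. sgn_parity k * F k)
      + sgn_parity (int (Suc K)) * (F (int (Suc K)) + F (- int (Suc K)))"
    by (simp only:, subst sum.insert, simp, simp, subst sum.insert)
      (simp_all add: sgn_parity_uminus[of "1 + _"] algebra_simps, simp add: sgn_parity_def)
  then show ?case
    by (simp only: sum.atMost_Suc Suc) (simp add: contraction_def distrib_left mult.assoc)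
qed

text \<open>The substitution \<open>s = k - m + c\<close> reduces this to
  \<open>sum_Qcoeff_alternating\<close>; the bound on \<open>K\<close> puts \<open>{0..L}\<close>
  inside the range of \<open>s\<close>.\<close>

lemma sum_Qcoeff_shifted:
  assumes "\<bar>m\<bar> + \<bar>n\<bar> + int c + int d \<le> K"
  shows "(\<Sum>k\<in>{- K..K}. sgn_parity k * (Qcoeff (k - m + int c) * Qcoeff (- n - k + int d))) =
    (if int c + int d = m + n then sgn_parity m * sgn_parity (int c) else 0)"
proof -
  let ?L = "int c + int d - m - n"
  have "(\<Sum>k\<in>{- K..K}. sgn_parity k * (Qcoeff (k - m + int c) * Qcoeff (- n - k + int d))) =
      (\<Sum>s\<in>{- K - m + int c..K - m + int c}.
        sgn_parity m * sgn_parity (int c) * (sgn_parity s * (Qcoeff s * Qcoeff (?L - s))))"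
    by (rule sum.reindex_bij_witness[of _ "\<lambda>s. s + m - int c" "\<lambda>k. k - m + int c"])
      (auto simp: sgn_parity_def algebra_simps)
  also have "\<dots> = sgn_parity m * sgn_parity (int c) * (if ?L = 0 then 1 else 0)"
    unfolding sum_distrib_left[symmetric]
    by (subst sum_Qcoeff_alternating) (use assms in auto)
  finally show ?thesis by auto
qed

lemma phi_anticommutator:
  assumes "f \<in> B_odd"
  shows "phi m (phi n f) + phi n (phi m f) = (if m + n = 0 then 2 * sgn_parity m * f else 0)"
proof -
  obtain B where B: "\<forall>c>B. shift f $ c = 0"
    using shift_eventually_zero by blast
  \<comment> \<open>Large enough for both products of modes and, as \<open>c\<close> and
    \<open>d\<close> are at most \<open>B\<close>, for \<open>sum_Qcoeff_shifted\<close>.\<close>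
  define K where "K = nat (\<bar>m\<bar> + \<bar>n\<bar> + 2 * int B)"
  define F where "F = (\<lambda>k. pair_sum f B (k - m) (- n - k))"
  have "phi m (phi n f) = (\<Sum>k\<le>K. contraction k * F (int k))"
    by (subst phi_phi_eq_sum[OF B, of n K]) (auto simp: K_def F_def)
  \<comment> \<open>Symmetry of the normally ordered product turns exchanging the modes into
    \<open>k \<mapsto> -k\<close>.\<close>
  moreover have "phi n (phi m f) = (\<Sum>k\<le>K. contraction k * F (- int k))"
    by (subst phi_phi_eq_sum[OF B, of m K])
      (auto simp: K_def F_def pair_sum_commute[of f B "_ - n"] minus_diff_commute intro!: sum.cong)
  ultimately have "phi m (phi n f) + phi n (phi m f) = 2 * (\<Sum>k\<in>{- int K..int K}. sgn_parity k * F k)"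
    by (simp add: distrib_left sum.distrib flip: sum_contraction_symmetric)
  also have "(\<Sum>k\<in>{- int K..int K}. sgn_parity k * F k) =
      (\<Sum>k\<in>{- int K..int K}. \<Sum>c\<le>B. \<Sum>d\<le>B. sgn_parity k *
        (Qcoeff (k - m + int c) * Qcoeff (- n - k + int d)) * shift2 f c d)"
    by (simp add: F_def pair_sum_def sum_distrib_left mult_ac)
  also have "\<dots> = (\<Sum>c\<le>B. \<Sum>k\<in>{- int K..int K}. \<Sum>d\<le>B. sgn_parity k *
        (Qcoeff (k - m + int c) * Qcoeff (- n - k + int d)) * shift2 f c d)"
    by (rule sum.swap)
  also have "\<dots> = (\<Sum>c\<le>B. \<Sum>d\<le>B. \<Sum>k\<in>{- int K..int K}. sgn_parity k *
        (Qcoeff (k - m + int c) * Qcoeff (- n - k + int d)) * shift2 f c d)"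
    by (intro sum.cong refl sum.swap)
  also have "\<dots> = (\<Sum>c\<le>B. \<Sum>d\<le>B. if int c + int d = m + n
      then sgn_parity m * (sgn_parity (int c) * shift2 f c d) else 0)"
    unfolding sum_distrib_right[symmetric]
    by (intro sum.cong refl, subst sum_Qcoeff_shifted) (auto simp: K_def)
  also have "\<dots> = (if m + n = 0 then sgn_parity m * f else 0)"
  proof (cases "m + n < 0")
    case False
    then obtain N where N: "m + n = int N"
      by (metis nat_0_le not_less)
    have "(\<Sum>c\<le>B. \<Sum>d\<le>B. if int c + int d = m + n
        then sgn_parity m * (sgn_parity (int c) * shift2 f c d) else 0) =
      (\<Sum>c\<le>B. if c \<le> N then sgn_parity m * (sgn_parity (int c) * shift2 f c (N - c)) else 0)"
    proof (intro sum.cong refl)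
      fix c
      have "(\<Sum>d\<le>B. if int c + int d = m + n
          then sgn_parity m * (sgn_parity (int c) * shift2 f c d) else 0) =
        (\<Sum>d\<le>B. if d = N - c then if c \<le> N
          then sgn_parity m * (sgn_parity (int c) * shift2 f c d) else 0 else 0)"
        by (intro sum.cong refl) (auto simp: N)
      also have "\<dots> = (if c \<le> N then sgn_parity m * (sgn_parity (int c) * shift2 f c (N - c)) else 0)"
        by (auto simp: shift2_eq_zero[OF B])
      finally show "(\<Sum>d\<le>B. if int c + int d = m + n
          then sgn_parity m * (sgn_parity (int c) * shift2 f c d) else 0) = \<dots>" .
    qed
    \<comment> \<open>Either of \<open>B\<close> and \<open>N\<close> may be larger; the terms with
      \<open>c > B\<close> vanish.\<close>
    also have "\<dots> = (\<Sum>c\<le>N. sgn_parity m * (sgn_parity (int c) * shift2 f c (N - c)))"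
      by (rule sum.mono_neutral_cong) (auto simp: shift2_eq_zero[OF B])
    also have "\<dots> = (if N = 0 then sgn_parity m * f else 0)"
      unfolding sum_distrib_left[symmetric] by (simp add: sum_shift2_alternating[OF assms])
    finally show ?thesis
      by (simp add: N)
  qed (auto intro!: sum.neutral)
  finally show ?thesis
    by (simp add: mult.assoc)
qed

lemma sgn_parity_eq_power_int: "sgn_parity m = ((-1) powi m :: complex)"
  by (simp add: sgn_parity_def power_int_minus_left)

lemma sgn_parity_mult_eq_smul: "sgn_parity m * f = smul ((-1) powi m) f"
  by (simp add: sgn_parity_def flip: sgn_parity_eq_power_int)

lemma neutral_relations_phi: "neutral_relations phi"
  unfolding neutral_relations_def
  by (simp add: phi_anticommutator mult.assoc sgn_parity_mult_eq_smul flip: symfun.scale_scale)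
    (simp add: smul_def)

section \<open>Linear combinations of neutral fermions\<close>

lemma phi_tilde_eq_sum:
  assumes "\<forall>i<M. A k i = 0" "\<forall>i>N. phi i f = 0"
  shows "phi_tilde A k f = (\<Sum>i\<in>{M..N}. smul (A k i) (phi i f))"
  unfolding phi_tilde_def
  using assms by (intro Sum_any.expand_superset) (auto simp: not_less[symmetric])

lemma phi_tilde_anticommutator:
  assumes "rows_bounded_below A" "f \<in> B_odd"
  shows "finite {k. A m k * twisted_transpose A k (- n) \<noteq> 0}" (is "finite ?supp")
    and "phi_tilde A m (phi_tilde A n f) + phi_tilde A n (phi_tilde A m f) =
      smul (2 * (-1) powi n * Sum_any (\<lambda>k. A m k * twisted_transpose A k (- n))) f"
proof -
  obtain M1 M2 where M12: "\<forall>i<M1. A m i = 0" "\<forall>i<M2. A n i = 0"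
    using assms(1) unfolding rows_bounded_below_def by blast
  define M where "M = min M1 M2"
  have M: "\<forall>i<M. A m i = 0" "\<forall>i<M. A n i = 0"
    using M12 by (auto simp: M_def)
  obtain N1 N2 N3 where N123: "\<forall>i>N1. phi i f = 0" "\<forall>i>N2. phi i (phi_tilde A m f) = 0"
    "\<forall>i>N3. phi i (phi_tilde A n f) = 0"
    using phi_eventually_zero by metis
  \<comment> \<open>Including \<open>- M\<close> makes \<open>{M..N}\<close> contain every
    \<open>k\<close> with both \<open>A m k\<close> and \<open>A n (- k)\<close> nonzero.\<close>
  define N where "N = max (max N1 N2) (max N3 (- M))"
  have N: "\<forall>i>N. phi i f = 0" "\<forall>i>N. phi i (phi_tilde A m f) = 0"
    "\<forall>i>N. phi i (phi_tilde A n f) = 0"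
    using N123 by (auto simp: N_def)
  have MN: "- M \<le> N"
    by (simp add: N_def)
  have supp: "?supp \<subseteq> {M..N}"
  proof
    fix k assume "k \<in> ?supp"
    then have "A m k \<noteq> 0" "A n (- k) \<noteq> 0"
      by (auto simp: twisted_transpose_def)
    with M have "\<not> k < M" "\<not> - k < M"
      by blast+
    with MN show "k \<in> {M..N}"
      by auto
  qed
  then show "finite ?supp"
    by (rule finite_subset) simp
  have "phi_tilde A m (phi_tilde A n f) =
      (\<Sum>i\<in>{M..N}. \<Sum>j\<in>{M..N}. smul (A m i * A n j) (phi i (phi j f)))"
    using M N
    by (simp add: phi_tilde_eq_sum[of M A m N] phi_tilde_eq_sum[of M A n N f]
        module_hom.sum[OF linear_phi] module_hom.scale[OF linear_phi] symfun.scale_sum_right)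
  moreover have "phi_tilde A n (phi_tilde A m f) =
      (\<Sum>i\<in>{M..N}. \<Sum>j\<in>{M..N}. smul (A m i * A n j) (phi j (phi i f)))"
    using M N
    by (subst sum.swap)
      (simp add: phi_tilde_eq_sum[of M A n N] phi_tilde_eq_sum[of M A m N f] mult.commute
        module_hom.sum[OF linear_phi] module_hom.scale[OF linear_phi] symfun.scale_sum_right)
  ultimately have "phi_tilde A m (phi_tilde A n f) + phi_tilde A n (phi_tilde A m f) =
      (\<Sum>i\<in>{M..N}. \<Sum>j\<in>{M..N}. smul (A m i * A n j) (phi i (phi j f) + phi j (phi i f)))"
    by (simp add: sum.distrib symfun.scale_right_distrib)
  also have "\<dots> = (\<Sum>i\<in>{M..N}. \<Sum>j\<in>{M..N}. if j = - i
      then smul (A m i * A n j * (2 * (-1) powi i)) f else 0)"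
    using neutral_relations_phi assms(2) unfolding neutral_relations_def
    by (intro sum.cong refl) auto
  also have "\<dots> = (\<Sum>i\<in>{M..N}. smul (A m i * A n (- i) * (2 * (-1) powi i)) f)"
  proof (intro sum.cong refl)
    fix i assume "i \<in> {M..N}"
    \<comment> \<open>From \<open>i \<ge> M\<close> follows \<open>- i \<le> - M \<le> N\<close>, so
      \<open>- i\<close> can leave the interval only below \<open>M\<close>.\<close>
    then have "A n (- i) = 0" if "- i \<notin> {M..N}"
      using that M(2) MN by auto
    then show "(\<Sum>j\<in>{M..N}. if j = - i then smul (A m i * A n j * (2 * (-1) powi i)) f else 0) =
        smul (A m i * A n (- i) * (2 * (-1) powi i)) f"
      by (auto simp: sum.delta)
  qed
  also have "\<dots> = smul (2 * (-1) powi n * (\<Sum>k\<in>{M..N}. A m k * twisted_transpose A k (- n))) f"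
    unfolding sum_distrib_left symfun.scale_sum_left
    by (intro sum.cong refl)
      (simp add: twisted_transpose_def power_int_add mult_ac)
  also have "(\<Sum>k\<in>{M..N}. A m k * twisted_transpose A k (- n)) =
      Sum_any (\<lambda>k. A m k * twisted_transpose A k (- n))"
    using supp by (intro Sum_any.expand_superset[symmetric]) auto
  finally show "phi_tilde A m (phi_tilde A n f) + phi_tilde A n (phi_tilde A m f) =
      smul (2 * (-1) powi n * Sum_any (\<lambda>k. A m k * twisted_transpose A k (- n))) f" .
qed

lemma neutral_relations_phi_tilde_iff:
  assumes "rows_bounded_below A"
  shows "neutral_relations (phi_tilde A) \<longleftrightarrow> left_inverse A (twisted_transpose A)"
proof -
  define P where "P = (\<lambda>i j. Sum_any (\<lambda>k. A i k * twisted_transpose A k j))"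
  \<comment> \<open>A nonzero test vector, from which equality of the scalars is read off.\<close>
  have one: "(1 :: symfun) \<in> B_odd"
    by (simp add: B_odd_def)
  have rhs: "(if m + n = 0 then smul (2 * (-1) powi m) f else 0) =
      smul (2 * (-1) powi n * (if m = - n then 1 else 0)) f" for m n :: int and f
    by (cases "m = - n") (auto simp: sgn_parity_uminus simp flip: sgn_parity_eq_power_int)
  have "neutral_relations (phi_tilde A) \<longleftrightarrow> (\<forall>m n. \<forall>f\<in>B_odd.
      smul (2 * (-1) powi n * P m (- n)) f = smul (2 * (-1) powi n * (if m = - n then 1 else 0)) f)"
    unfolding neutral_relations_def rhs
    using phi_tilde_anticommutator(2)[OF assms] by (simp add: P_def)
  also have "\<dots> \<longleftrightarrow> (\<forall>m n. P m (- n) = (if m = - n then 1 else 0))"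
    using one by (auto simp: symfun.scale_cancel_right)
  also have "\<dots> \<longleftrightarrow> (\<forall>i j. P i j = (if i = j then 1 else 0))"
    by (metis minus_minus)
  also have "\<dots> \<longleftrightarrow> left_inverse A (twisted_transpose A)"
    unfolding left_inverse_def P_def
    using phi_tilde_anticommutator(1)[OF assms one] by (metis minus_minus)
  finally show ?thesis .
qed

section \<open>Continuous matrices and their inverses\<close>

lemma rows_uniformly_bounded_below:
  assumes "rows_bounded_below A" "finite I"
  shows "\<exists>N. \<forall>i\<in>I. \<forall>j<N. A i j = 0"
  using assms(2)
proof (induction I)
  case (insert i I)
  then obtain N where N: "\<forall>i\<in>I. \<forall>j<N. A i j = 0" by blast
  obtain N' where "\<forall>j<N'. A i j = 0"
    using assms(1) unfolding rows_bounded_below_def by blast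
  with N show ?case
    by (intro exI[of _ "min N N'"]) auto
qed simp

lemma continuous_matrix_twisted_transpose:
  assumes "continuous_matrix A"
  shows "continuous_matrix (twisted_transpose A)"
  unfolding continuous_matrix_def rows_bounded_below_def
proof (intro conjI allI)
  fix i
  \<comment> \<open>The strict bound \<open>- i + 1\<close> is needed to reach column
    \<open>- i\<close> itself.\<close>
  obtain K where "\<forall>k>K. \<forall>j < - i + 1. A k j = 0"
    using assms unfolding continuous_matrix_def by blast
  then show "\<exists>N. \<forall>j<N. twisted_transpose A i j = 0"
    by (intro exI[of _ "- K"]) (auto simp: twisted_transpose_def)
next
  fix N
  obtain K where K: "\<forall>k>K. \<forall>j<0. A k j = 0"
    using assms unfolding continuous_matrix_def by blast
  obtain M where M: "\<forall>k\<in>{- N..K}. \<forall>j<M. A k j = 0"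
    using rows_uniformly_bounded_below[of A "{- N..K}"] assms
    unfolding continuous_matrix_def by blast
  \<comment> \<open>Rows beyond \<open>K\<close> vanish in negative columns; only the finitely many
    rows in \<open>{- N..K}\<close> remain, with common bound \<open>M\<close>.\<close>
  have "A (- j) (- k) = 0" if "k > max 0 (- M)" "j < N" for k j
  proof (cases "- j > K")
    case True
    with K that show ?thesis by auto
  next
    case False
    with that have "- j \<in> {- N..K}" "- k < M" by auto
    with M show ?thesis by blast
  qed
  then show "\<exists>K. \<forall>k>K. \<forall>j<N. twisted_transpose A k j = 0"
    by (intro exI[of _ "max 0 (- M)"]) (auto simp: twisted_transpose_def)
qed

text \<open>The usual \<open>C = C (A D) = (C A) D = D\<close>; continuity confines both summations
  to finite windows, so they may be interchanged.\<close>

lemma left_inverse_eq_right_inverse: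
  assumes C: "continuous_matrix C" and A: "continuous_matrix A" and D: "continuous_matrix D"
    and CA: "left_inverse C A" and AD: "left_inverse A D"
  shows "C = D"
proof (intro ext)
  fix i j
  obtain k0 where k0: "\<forall>k<k0. C i k = 0"
    using C unfolding continuous_matrix_def rows_bounded_below_def by blast
  obtain L where L: "\<forall>l>L. D l j = 0"
    using D unfolding continuous_matrix_def by (metis less_add_one)
  obtain K0 where K0: "\<forall>k>K0. \<forall>l<L + 1. A k l = 0"
    using A unfolding continuous_matrix_def by blast
  \<comment> \<open>The windows must contain the diagonal positions: \<open>j\<close> is covered
    above here and \<open>i\<close> below by \<open>l0\<close>. If \<open>j < k0\<close> or
    \<open>i > L\<close>, the entry \<open>C i j\<close> or \<open>D i j\<close> is zero
    anyway.\<close>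
  define K where "K = max K0 j"
  obtain l1 where l1: "\<forall>k\<in>{k0..K}. \<forall>l<l1. A k l = 0"
    using rows_uniformly_bounded_below[of A "{k0..K}"] A unfolding continuous_matrix_def by blast
  define l0 where "l0 = min l1 i"
  have CA': "(\<Sum>k\<in>{k0..K}. C i k * A k l) = (if i = l then 1 else 0)" if "l \<le> L" for l
  proof -
    have "Sum_any (\<lambda>k. C i k * A k l) = (\<Sum>k\<in>{k0..K}. C i k * A k l)"
      using k0 K0 that by (intro Sum_any.expand_superset) (auto simp: K_def not_less[symmetric])
    with CA show ?thesis
      unfolding left_inverse_def by metis
  qed
  have AD': "(\<Sum>l\<in>{l0..L}. A k l * D l j) = (if k = j then 1 else 0)" if "k \<in> {k0..K}" for k
  proof -
    have "Sum_any (\<lambda>l. A k l * D l j) = (\<Sum>l\<in>{l0..L}. A k l * D l j)"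
      using L l1 that by (intro Sum_any.expand_superset) (auto simp: l0_def not_less[symmetric])
    with AD show ?thesis
      unfolding left_inverse_def by metis
  qed
  have "C i j = (\<Sum>k\<in>{k0..K}. C i k * (if k = j then 1 else 0))"
    using k0 by (auto simp: K_def if_distrib[of "(*) _"] not_le cong: if_cong)
  also have "\<dots> = (\<Sum>k\<in>{k0..K}. \<Sum>l\<in>{l0..L}. C i k * A k l * D l j)"
    by (intro sum.cong refl) (simp add: mult.assoc flip: AD' sum_distrib_left)
  also have "\<dots> = (\<Sum>l\<in>{l0..L}. \<Sum>k\<in>{k0..K}. C i k * A k l * D l j)"
    by (rule sum.swap)
  also have "\<dots> = (\<Sum>l\<in>{l0..L}. (if i = l then 1 else 0) * D l j)"
    by (intro sum.cong refl) (simp add: CA' flip: sum_distrib_right)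
  also have "\<dots> = D i j"
    using L by (auto simp: l0_def if_distrib[of "\<lambda>x. x * _"] not_le cong: if_cong)
  finally show "C i j = D i j" .
qed

theorem proposition3p2:
  fixes A :: cmatrix
  assumes "rows_bounded_below A"
  shows "(neutral_relations (phi_tilde A) \<longleftrightarrow> left_inverse A (twisted_transpose A)) \<and>
    (invertible_matrix A \<longrightarrow>
      (neutral_relations (phi_tilde A) \<longleftrightarrow> left_inverse (twisted_transpose A) A))"
proof -
  \<comment> \<open>A one-sided inverse of \<open>A\<close> that is continuous equals the given
    two-sided one, and so is itself two-sided.\<close>
  have "left_inverse A (twisted_transpose A) \<longleftrightarrow> left_inverse (twisted_transpose A) A"
    if "invertible_matrix A"
    using that left_inverse_eq_right_inverse continuous_matrix_twisted_transpose
    unfolding invertible_matrix_def by metis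
  then show ?thesis
    by (simp add: neutral_relations_phi_tilde_iff[OF assms])
qed

end
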